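(* Let the total system relative to $R_i$ in some orientation $g_i\in\mathcal G$ be prepared in a global state $\rho_{\bar i}\in\mathcal S(\mathcal H_{\bar i})$ of the form $$\rho_{\bar i}=\rho_j\otimes\tfrac1Ze^{-\beta H_{S|R_i}}$$ and let the Hamiltonian $H_{S|R_i}$ be such that there exists a strict subset $\mathcal G_{\rm a}\subsetneq\mathcal G$ with $$\{U_S^h,H_{S|R_i}\}=0\quad\forall h\in\mathcal G_{\rm a},\qquad\text{and}\qquad [U_S^g,H_{S|R_i}]=0\quad\forall g\in\mathcal G_{\rm c}:=\mathcal G\setminus\mathcal G_{\rm a}.$$ Then the subsystem state relative to $R_j$ ($i\neq j$) in some orientation $g_j\in\mathcal G$ is $$\rho_{S|R_j}=q_{\rm a}^{g_j}\,\tfrac1Z\,e^{+\beta H_{S|R_i}}+(1-q_{\rm a}^{g_j})\,\tfrac1Z\,e^{-\beta H_{S|R_i}},\qquad q_{\rm a}^{g_j}=\sum_{h\in\mathcal G_{\rm a}}\langle g_jh^{-1}|\rho_j|g_jh^{-1}\rangle_j.$$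
   Context: $\mathcal G$ is a finite abelian group, $\mathcal G\neq\{e\}$. For $i=1,2$ (two ideal quantum reference frames $R_1,R_2$), $\mathcal H_i=\ell^2(\mathcal G)$ has orthonormal basis $\{|g\rangle_i\}_{g\in\mathcal G}$. $\mathcal H_S$ is a finite-dimensional complex Hilbert space carrying a unitary representation $g\mapsto U_S^g$ of $\mathcal G$. For $i\neq j$ in $\{1,2\}$, $\mathcal H_{\bar i}=\mathcal H_j\otimes\mathcal H_S$ (the description of $R_j$ and $S$ relative to $R_i$); $\mathcal S(\cdot)$ denotes density operators. $\rho_j$ is a density operator on $\mathcal H_j$, $H_{S|R_i}$ a self-adjoint operator on $\mathcal H_S$, $\beta\in\mathbb R$, $Z=\mathrm{Tr}\,e^{-\beta H_{S|R_i}}$, and $\{A,B\}=AB+BA$. The frame change is the unitary $V_{i\to j}^{g_i,g_j}=\sum_{g\in\mathcal G}|gg_i\rangle_i\otimes\langle g_jg^{-1}|_j\otimes U_S^g:\mathcal H_{\bar i}\to\mathcal H_{\bar j}$; the state relative to $R_j$ is $\rho_{\bar j}=V_{i\to j}^{g_i,g_j}\rho_{\bar i}(V_{i\to j}^{g_i,g_j})^\dagger$, and $\rho_{S|R_j}=\mathrm{Tr}_i(\rho_{\bar j})$. *)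

theory Defs
  imports "HOL-Analysis.Analysis"
begin

text \<open>
  A finite-dimensional Hilbert space is written in an orthonormal basis indexed by a finite type:
  \<open>complex^'g\<close> with \<open>'g :: {finite, ab_group_add}\<close> is \<open>\<ell>\<^sup>2\<close> of the finite abelian group \<open>'g\<close>
  (written additively), \<open>complex^'s\<close> is the system space, and \<open>complex^('g \<times> 's)\<close> is their
  tensor product.  Operators are matrices, with entry \<open>A $ row $ column\<close>.
\<close>

type_synonym 'n operator = "complex^'n^'n"

definition cscale :: "complex \<Rightarrow> complex^'n^'m \<Rightarrow> complex^'n^'m" (infixr "*\<^sub>C" 75)
  where "c *\<^sub>C A = (\<chi> i j. c * A $ i $ j)"

definition dagger :: "complex^'n^'m \<Rightarrow> complex^'m^'n"
  where "dagger A = (\<chi> i j. cnj (A $ j $ i))"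

definition braket :: "complex^'n \<Rightarrow> complex^'n \<Rightarrow> complex"
  where "braket x y = (\<Sum>i\<in>UNIV. cnj (x $ i) * y $ i)"

definition ket :: "'n::finite \<Rightarrow> complex^'n"
  where "ket n = axis n 1"

definition ketbra :: "complex^'m \<Rightarrow> complex^'n \<Rightarrow> complex^'n^'m"
  where "ketbra x y = (\<chi> i j. x $ i * cnj (y $ j))"

definition kron :: "complex^'n^'m \<Rightarrow> complex^'q^'p \<Rightarrow> complex^('n \<times> 'q)^('m \<times> 'p)" (infixr "\<otimes>" 70)
  where "A \<otimes> B = (\<chi> r c. A $ fst r $ fst c * B $ snd r $ snd c)"

definition ptrace_fst :: "('a::finite \<times> 's::finite) operator \<Rightarrow> 's operator"
  where "ptrace_fst A = (\<chi> r c. \<Sum>k\<in>UNIV. A $ (k, r) $ (k, c))"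

definition self_adjoint :: "'n::finite operator \<Rightarrow> bool"
  where "self_adjoint A \<longleftrightarrow> dagger A = A"

definition unitary_op :: "'n::finite operator \<Rightarrow> bool"
  where "unitary_op A \<longleftrightarrow> dagger A ** A = mat 1 \<and> A ** dagger A = mat 1"

definition density_operator :: "'n::finite operator \<Rightarrow> bool"
  where "density_operator \<rho> \<longleftrightarrow>
    self_adjoint \<rho> \<and> (\<forall>x. 0 \<le> Re (braket x (\<rho> *v x))) \<and> trace \<rho> = 1"

definition commutator :: "'n::finite operator \<Rightarrow> 'n operator \<Rightarrow> 'n operator"
  where "commutator A B = A ** B - B ** A"

definition anticommutator :: "'n::finite operator \<Rightarrow> 'n operator \<Rightarrow> 'n operator"
  where "anticommutator A B = A ** B + B ** A"

text \<open>
  The type of matrices is not an instance of the classes required by \<^const>\<open>exp\<close>, so the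
  exponential series is summed in the normed space of matrices.
\<close>

definition mexp :: "'n::finite operator \<Rightarrow> 'n operator"
  where "mexp A = (\<Sum>n. (((**) A ^^ n) (mat 1)) /\<^sub>R fact n)"

definition unitary_rep :: "('g::ab_group_add \<Rightarrow> 's::finite operator) \<Rightarrow> bool"
  where "unitary_rep U \<longleftrightarrow>
    (\<forall>g. unitary_op (U g)) \<and> U 0 = mat 1 \<and> (\<forall>g h. U (g + h) = U g ** U h)"

text \<open>
  The frame change from orientation \<open>g\<^sub>i\<close> of the first frame to orientation \<open>g\<^sub>j\<close> of the second.
  It maps \<open>\<H>\<^sub>j \<otimes> \<H>\<^sub>S\<close> to \<open>\<H>\<^sub>i \<otimes> \<H>\<^sub>S\<close>; both frame spaces are copies of \<open>complex^'g\<close>, so the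
  operator \<open>|x\<rangle>\<^sub>i \<langle>y|\<^sub>j\<close> between them is a square matrix.
\<close>

definition frame_change ::
    "('g::{finite,ab_group_add} \<Rightarrow> 's::finite operator) \<Rightarrow> 'g \<Rightarrow> 'g \<Rightarrow> ('g \<times> 's) operator"
  where "frame_change U gi gj = (\<Sum>g\<in>UNIV. ketbra (ket (g + gi)) (ket (gj - g)) \<otimes> U g)"

end

theory Submission
  imports Defs
begin

text \<open>
  Conjugating the product state by the frame change and tracing out the first frame leaves the
  mixture of the conjugates \<open>U g \<tau> (U g)\<^sup>\<dagger>\<close> of the Gibbs state \<open>\<tau>\<close>, weighted by the diagonal
  entries \<open>\<langle>g\<^sub>j - g|\<rho>\<^sub>j|g\<^sub>j - g\<rangle>\<close>: the off-diagonal terms vanish because distinct \<open>g\<close> send the first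
  frame to orthogonal basis vectors.  If \<open>U g\<close> commutes with \<open>H\<close>, the Gibbs state is fixed; if it
  anticommutes, then \<open>U g\<close> intertwines \<open>-\<beta>H\<close> with \<open>\<beta>H\<close>, hence also their exponentials.
\<close>

lemma bounded_linear_matrix_mult_left:
  "bounded_linear (\<lambda>X :: complex^'n^'m. (A :: complex^'m^'k) ** X)"
  unfolding linear_conv_bounded_linear [symmetric]
  by (rule linearI)
    (simp_all add: vec_eq_iff matrix_matrix_mult_def scaleR_sum_right sum.distrib distrib_left)

lemma bounded_linear_matrix_mult_right:
  "bounded_linear (\<lambda>X :: complex^'m^'k. X ** (A :: complex^'n^'m))"
  unfolding linear_conv_bounded_linear [symmetric]
  by (rule linearI)
    (simp_all add: vec_eq_iff matrix_matrix_mult_def scaleR_sum_right sum.distrib distrib_right)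

text \<open>The series is dominated by a constant multiple of the scalar exponential series of a
  number \<open>K\<close> bounding left multiplication by \<open>A\<close>.\<close>

lemma summable_mexp:
  "summable (\<lambda>n. (((**) A ^^ n) (mat 1)) /\<^sub>R fact n :: 'n::finite operator)"
proof -
  obtain K where K: "\<And>X :: 'n operator. norm (A ** X) \<le> norm X * K" and "0 \<le> K"
    using bounded_linear.nonneg_bounded [OF bounded_linear_matrix_mult_left [of A]] by metis
  \<comment> \<open>The norm is that of the underlying vector type, in which the identity need not
    have norm 1; hence the extra factor.\<close>
  define c where "c = norm (mat 1 :: 'n operator)"
  have pow: "norm (((**) A ^^ n) (mat 1)) \<le> K ^ n * c" for n
  proof (induction n)
    case 0
    show ?case by (simp add: c_def)
  next
    case (Suc n)
    have "norm (((**) A ^^ Suc n) (mat 1)) \<le> norm (((**) A ^^ n) (mat 1)) * K"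
      using K by simp
    also have "\<dots> \<le> (K ^ n * c) * K"
      using Suc \<open>0 \<le> K\<close> by (rule mult_right_mono)
    finally show ?case by (simp add: ac_simps)
  qed
  have bound: "norm ((((**) A ^^ n) (mat 1)) /\<^sub>R fact n) \<le> (K ^ n /\<^sub>R fact n) * c" for n
    using mult_left_mono [OF pow [of n], of "inverse (fact n)"] by (simp add: mult.assoc)
  have "summable (\<lambda>n. (K ^ n /\<^sub>R fact n) * c)"
    by (intro summable_mult2 summable_exp_generic)
  then show ?thesis
    using bound by (rule summable_comparison_test')
qed

text \<open>Induction moves \<open>X\<close> past one factor at a time, turning each
  \<open>A\<close> into \<open>B\<close>; continuity of multiplication carries this through the
  series. Allowing \<open>A\<close> and \<open>B\<close> to differ serves the commuting and the
  anticommuting case alike.\<close>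

lemma mexp_intertwine:
  fixes X :: "complex^'n^'m"
  assumes "X ** A = B ** X"
  shows "X ** mexp A = mexp B ** X"
proof -
  have pow: "X ** (((**) A ^^ n) (mat 1)) = (((**) B ^^ n) (mat 1)) ** X" for n
  proof (induction n)
    case (Suc n)
    then show ?case using assms by simp (metis matrix_mul_assoc)
  qed simp
  interpret L: bounded_linear "\<lambda>Y. X ** Y" by (rule bounded_linear_matrix_mult_left)
  interpret R: bounded_linear "\<lambda>Y. Y ** X" by (rule bounded_linear_matrix_mult_right)
  show ?thesis
    unfolding mexp_def L.suminf [OF summable_mexp] R.suminf [OF summable_mexp]
    by (simp add: L.scaleR R.scaleR pow)
qed

lemma mexp_conjugate:
  assumes "unitary_op V" and "V ** A = B ** V"
  shows "V ** mexp A ** dagger V = mexp B"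
  using assms mexp_intertwine [OF assms(2)]
  by (simp add: unitary_op_def flip: matrix_mul_assoc)

lemma cscale_conjugate: "A ** (c *\<^sub>C B) ** D = c *\<^sub>C (A ** B ** D)"
  by (simp add: vec_eq_iff cscale_def matrix_matrix_mult_def sum_distrib_left sum_distrib_right
      ac_simps)

lemma cscale_sum_left: "(\<Sum>i\<in>I. f i) *\<^sub>C A = (\<Sum>i\<in>I. f i *\<^sub>C A)"
  by (simp add: vec_eq_iff cscale_def sum_distrib_right)

lemma dagger_sum: "dagger (\<Sum>i\<in>I. f i) = (\<Sum>i\<in>I. dagger (f i))"
  by (simp add: vec_eq_iff dagger_def)

lemma dagger_kron: "dagger (A \<otimes> B) = dagger A \<otimes> dagger B"
  by (simp add: vec_eq_iff dagger_def kron_def)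

lemma dagger_ketbra: "dagger (ketbra x y) = ketbra y x"
  by (simp add: vec_eq_iff dagger_def ketbra_def)

text \<open>The sum over the paired inner index is a double sum of products, which factors into one
  sum per tensor leg.\<close>

lemma kron_mult: "(A \<otimes> B) ** (C \<otimes> D) = (A ** C) \<otimes> (B ** D)"
proof -
  have "((A \<otimes> B) ** (C \<otimes> D)) $ r $ c = ((A ** C) \<otimes> (B ** D)) $ r $ c" for r c
  proof -
    have "((A \<otimes> B) ** (C \<otimes> D)) $ r $ c
        = (\<Sum>(k, l)\<in>UNIV \<times> UNIV.
            (A $ fst r $ k * C $ k $ fst c) * (B $ snd r $ l * D $ l $ snd c))"
      unfolding UNIV_Times_UNIV
      by (auto simp: matrix_matrix_mult_def kron_def intro!: sum.cong)
    also have "\<dots> = ((A ** C) \<otimes> (B ** D)) $ r $ c"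
      \<comment> \<open>The index set must stay a visible product for the sum over pairs to unfold
        into an iterated one.\<close>
      by (simp add: matrix_matrix_mult_def kron_def sum_product del: UNIV_Times_UNIV
          flip: sum.cartesian_product)
    finally show ?thesis .
  qed
  then show ?thesis by (simp add: vec_eq_iff)
qed

lemma ptrace_fst_sum: "ptrace_fst (\<Sum>i\<in>I. f i) = (\<Sum>i\<in>I. ptrace_fst (f i))"
  by (simp add: vec_eq_iff ptrace_fst_def) (intro allI sum.swap)

lemma ptrace_fst_kron: "ptrace_fst (A \<otimes> B) = trace A *\<^sub>C B"
  by (simp add: vec_eq_iff ptrace_fst_def kron_def cscale_def trace_def sum_distrib_right)

lemma sum_matrix_mult_left:
  fixes f :: "'i \<Rightarrow> complex^'m^'k"
  shows "(\<Sum>i\<in>I. f i) ** A = (\<Sum>i\<in>I. f i ** A)"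
  by (rule linear_sum [OF bounded_linear.linear [OF bounded_linear_matrix_mult_right]])

lemma sum_matrix_mult_right:
  fixes f :: "'i \<Rightarrow> complex^'n^'m"
  shows "A ** (\<Sum>i\<in>I. f i) = (\<Sum>i\<in>I. A ** f i)"
  by (rule linear_sum [OF bounded_linear.linear [OF bounded_linear_matrix_mult_left]])

lemma braket_ket: "braket (ket a) (A *v ket b) = A $ a $ b"
proof -
  have "braket (ket a) y = y $ a" for y
    by (simp add: braket_def ket_def axis_def if_distrib [of cnj] if_distrib [of "\<lambda>x. x * _"]
        cong: if_cong)
  then show ?thesis
    by (simp add: ket_def matrix_vector_mul_component inner_vec_def axis_def matrix_vector_mult_def
        if_distrib [of "\<lambda>x. _ * x"] cong: if_cong)
qed

lemma ketbra_ket: "ketbra (ket a) (ket b) $ i $ j = (if i = a then if j = b then 1 else 0 else 0)"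
  by (simp add: ketbra_def ket_def axis_def)

lemma ketbra_ket_mult: "(ketbra (ket a) (ket b) ** A) $ i $ j = (if i = a then A $ b $ j else 0)"
  by (simp add: matrix_matrix_mult_def ketbra_ket if_distrib [of "\<lambda>x. x * _"] cong: if_cong)

lemma mult_ketbra_ket: "(A ** ketbra (ket c) (ket d)) $ i $ j = (if j = d then A $ i $ c else 0)"
  by (cases "j = d")
    (simp_all add: matrix_matrix_mult_def ketbra_ket if_distrib [of "\<lambda>x. _ * x"] cong: if_cong)

text \<open>The product is the entry of \<open>A\<close> at \<open>(b, c)\<close> times the operator
  \<open>ketbra (ket a) (ket d)\<close>, whose trace is 1 or 0. This orthogonality removes the
  off-diagonal terms of the frame change.\<close>

lemma trace_ketbra_conjugate:
  "trace (ketbra (ket a) (ket b) ** A ** ketbra (ket c) (ket d))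
    = (if a = d then A $ b $ c else 0)"
  by (auto simp: trace_def ketbra_ket_mult mult_ketbra_ket)

lemma ptrace_fst_frame_change:
  fixes U :: "'g::{finite,ab_group_add} \<Rightarrow> 's::finite operator"
  shows "ptrace_fst (frame_change U gi gj ** (\<rho> \<otimes> \<tau>) ** dagger (frame_change U gi gj))
    = (\<Sum>g\<in>UNIV. \<rho> $ (gj - g) $ (gj - g) *\<^sub>C (U g ** \<tau> ** dagger (U g)))"
proof -
  have "ptrace_fst (frame_change U gi gj ** (\<rho> \<otimes> \<tau>) ** dagger (frame_change U gi gj))
      = (\<Sum>h\<in>UNIV. \<Sum>g\<in>UNIV. (if g = h then \<rho> $ (gj - g) $ (gj - h) else 0)
          *\<^sub>C (U g ** \<tau> ** dagger (U h)))"
    by (simp add: frame_change_def dagger_sum dagger_kron dagger_ketbra sum_matrix_mult_left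
        sum_matrix_mult_right kron_mult ptrace_fst_sum ptrace_fst_kron trace_ketbra_conjugate)
  also have "\<dots> = (\<Sum>h\<in>UNIV. \<Sum>g\<in>UNIV. if g = h
      then \<rho> $ (gj - h) $ (gj - h) *\<^sub>C (U h ** \<tau> ** dagger (U h)) else 0)"
    by (intro sum.cong refl) (auto simp: cscale_def vec_eq_iff)
  finally show ?thesis by simp
qed

theorem lemma11:
  fixes U :: "'g::{finite,ab_group_add} \<Rightarrow> 's::finite operator"
    and H :: "'s operator"
    and \<rho>\<^sub>j :: "'g operator"
    and \<rho>_bar_i \<rho>_bar_j :: "('g \<times> 's) operator"
    and \<rho>_S_Rj :: "'s operator"
    and \<beta> :: real
    and Z q\<^sub>a :: complex
    and G\<^sub>a G\<^sub>c :: "'g set"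
    and g\<^sub>i g\<^sub>j :: 'g
  assumes nontrivial: "(UNIV :: 'g set) \<noteq> {0}"
    and rep: "unitary_rep U"
    and frame_state: "density_operator \<rho>\<^sub>j"
    and hamiltonian: "self_adjoint H"
    and Z: "Z = trace (mexp (- \<beta> *\<^sub>R H))"
    and global_state: "density_operator \<rho>_bar_i"
    and product_form: "\<rho>_bar_i = \<rho>\<^sub>j \<otimes> ((1 / Z) *\<^sub>C mexp (- \<beta> *\<^sub>R H))"
    and strict: "G\<^sub>a \<subset> UNIV"
    and complement: "G\<^sub>c = UNIV - G\<^sub>a"
    and anticommute: "\<forall>h\<in>G\<^sub>a. anticommutator (U h) H = 0"
    and commute: "\<forall>g\<in>G\<^sub>c. commutator (U g) H = 0"
    and state_change: "\<rho>_bar_j = frame_change U g\<^sub>i g\<^sub>j ** \<rho>_bar_i ** dagger (frame_change U g\<^sub>i g\<^sub>j)"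
    and subsystem: "\<rho>_S_Rj = ptrace_fst \<rho>_bar_j"
    and q: "q\<^sub>a = (\<Sum>h\<in>G\<^sub>a. braket (ket (g\<^sub>j - h)) (\<rho>\<^sub>j *v ket (g\<^sub>j - h)))"
  shows "\<rho>_S_Rj = q\<^sub>a *\<^sub>C (1 / Z) *\<^sub>C mexp (\<beta> *\<^sub>R H)
                + (1 - q\<^sub>a) *\<^sub>C (1 / Z) *\<^sub>C mexp (- \<beta> *\<^sub>R H)"
proof -
  define w where "w g = \<rho>\<^sub>j $ (g\<^sub>j - g) $ (g\<^sub>j - g)" for g
  \<comment> \<open>Reflection in the orientation permutes the group, so the weights run through the
    whole diagonal of the frame state and sum to its trace.\<close>
  have "bij (\<lambda>g. g\<^sub>j - g)"
    by (rule involuntory_imp_bij) simp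
  then have "(\<Sum>g\<in>UNIV. w g) = trace \<rho>\<^sub>j"
    unfolding w_def trace_def by (rule sum.reindex_bij_betw)
  then have w_total: "(\<Sum>g\<in>UNIV. w g) = 1"
    using frame_state by (simp add: density_operator_def)
  have w_a: "(\<Sum>g\<in>G\<^sub>a. w g) = q\<^sub>a"
    by (simp add: q braket_ket w_def)
  have w_c: "(\<Sum>g\<in>G\<^sub>c. w g) = 1 - q\<^sub>a"
    using w_total w_a complement by (simp add: sum_diff)
  have unitary: "unitary_op (U g)" for g
    using rep by (simp add: unitary_rep_def)
  have conj_a: "U g ** mexp (- \<beta> *\<^sub>R H) ** dagger (U g) = mexp (\<beta> *\<^sub>R H)" if "g \<in> G\<^sub>a" for g
  proof (rule mexp_conjugate [OF unitary])
    have "U g ** (- \<beta> *\<^sub>R H) = - \<beta> *\<^sub>R (U g ** H)"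
      by (rule linear_scale [OF bounded_linear.linear [OF bounded_linear_matrix_mult_left]])
    also have "U g ** H = - (H ** U g)"
      using anticommute that by (simp add: anticommutator_def eq_neg_iff_add_eq_0)
    \<comment> \<open>The sign from anticommutation cancels the sign of the Gibbs exponent, which
      inverts the temperature.\<close>
    also have "- \<beta> *\<^sub>R - (H ** U g) = \<beta> *\<^sub>R H ** U g"
      by (simp add: linear_scale [OF bounded_linear.linear [OF bounded_linear_matrix_mult_right]])
    finally show "U g ** (- \<beta> *\<^sub>R H) = \<beta> *\<^sub>R H ** U g" .
  qed
  have conj_c: "U g ** mexp (- \<beta> *\<^sub>R H) ** dagger (U g) = mexp (- \<beta> *\<^sub>R H)" if "g \<in> G\<^sub>c" for g
  proof (rule mexp_conjugate [OF unitary])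
    have "U g ** H = H ** U g"
      using commute that by (simp add: commutator_def)
    then show "U g ** (- \<beta> *\<^sub>R H) = - \<beta> *\<^sub>R H ** U g"
      by (simp only: linear_scale [OF bounded_linear.linear [OF bounded_linear_matrix_mult_left]]
          linear_scale [OF bounded_linear.linear [OF bounded_linear_matrix_mult_right]])
  qed
  let ?f = "\<lambda>g. w g *\<^sub>C (1 / Z) *\<^sub>C (U g ** mexp (- \<beta> *\<^sub>R H) ** dagger (U g))"
  have "\<rho>_S_Rj = (\<Sum>g\<in>UNIV. ?f g)"
    by (simp add: subsystem state_change product_form ptrace_fst_frame_change cscale_conjugate
        w_def)
  \<comment> \<open>On each of the two sets the conjugated exponential is constant, so only the
    total weight of that set survives.\<close>
  also have "\<dots> = (\<Sum>g\<in>G\<^sub>a. ?f g) + (\<Sum>g\<in>G\<^sub>c. ?f g)"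
    unfolding complement by (subst add.commute, rule sum.subset_diff) auto
  also have "(\<Sum>g\<in>G\<^sub>a. ?f g) = q\<^sub>a *\<^sub>C (1 / Z) *\<^sub>C mexp (\<beta> *\<^sub>R H)"
    unfolding w_a [symmetric] cscale_sum_left by (simp only: conj_a cong: sum.cong)
  also have "(\<Sum>g\<in>G\<^sub>c. ?f g) = (1 - q\<^sub>a) *\<^sub>C (1 / Z) *\<^sub>C mexp (- \<beta> *\<^sub>R H)"
    unfolding w_c [symmetric] cscale_sum_left by (simp only: conj_c cong: sum.cong)
  finally show ?thesis .
qed

end
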